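(* A coherent quantale $A$ is an $mp$-quantale if and only if its reticulation $L(A)$ is a conormal lattice.
   Context: A quantale here means a complete lattice $A$ with bottom $0$ and top $1$, with an associative commutative multiplication that distributes over arbitrary joins and has $1$ as unit. $K(A)$ is the set of compact elements. $A$ is coherent if every element is a join of compact elements, $1\in K(A)$, and $K(A)$ is closed under multiplication. An element $p<1$ is $m$-prime if for all $a,b\in A$, $ab\leq p$ implies $a\leq p$ or $b\leq p$; $Spec(A)$ is the set of $m$-prime elements and $Min(A)$ is the set of minimal elements of $Spec(A)$. $A$ is an $mp$-quantale if for any $p\in Spec(A)$ there exists a unique $q\in Min(A)$ with $q\leq p$. The reticulation of $A$ is the (unique up to isomorphism) bounded distributive lattice $L(A)$ with a surjection $\lambda_A: K(A)\to L(A)$ such that for all $a,b\in K(A)$: $\lambda_A(a\vee b)\leq\lambda_A(a)\vee\lambda_A(b)$; $\lambda_A(ab)=\lambda_A(a)\wedge\lambda_A(b)$; and $\lambda_A(a)\leq\lambda_A(b)$ iff $a^n\leq b$ for some integer $n\geq1$. A bounded distributive lattice $L$ is conormal if for all $x,y\in L$ with $x\wedge y=0$ there exist $u,v\in L$ with $x\wedge u=y\wedge v=0$ and $u\vee v=1$. *)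

theory Defs
  imports Main
begin

class quantale = complete_lattice + comm_monoid_mult +
  assumes mult_Sup: "a * Sup B = (SUP b\<in>B. a * b)"
    and one_eq_top: "1 = top"

text \<open>The library's \<open>ccpo.compact\<close> is formulated with chains and admissibility; this is the
  usual finite-subcover form, meaningful in any complete lattice.\<close>

definition (in complete_lattice) compact_element :: "'a \<Rightarrow> bool" where
  "compact_element c \<longleftrightarrow> (\<forall>X. c \<le> Sup X \<longrightarrow> (\<exists>F. finite F \<and> F \<subseteq> X \<and> c \<le> Sup F))"

definition (in complete_lattice) compacts :: "'a set" where
  "compacts = {c. compact_element c}"

class coherent_quantale = quantale +
  assumes ex_compacts_Sup: "\<exists>C\<subseteq>compacts. a = Sup C"
    and one_compact: "1 \<in> compacts"
    and mult_compact: "a \<in> compacts \<Longrightarrow> b \<in> compacts \<Longrightarrow> a * b \<in> compacts"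

definition m_prime :: "'a::quantale \<Rightarrow> bool" where
  "m_prime p \<longleftrightarrow> p < 1 \<and> (\<forall>a b. a * b \<le> p \<longrightarrow> a \<le> p \<or> b \<le> p)"

definition Spec :: "'a::quantale set" where
  "Spec = {p. m_prime p}"

definition Min_Spec :: "'a::quantale set" where
  "Min_Spec = {q \<in> Spec. \<forall>p\<in>Spec. p \<le> q \<longrightarrow> p = q}"

definition mp_quantale :: "'a::quantale itself \<Rightarrow> bool" where
  "mp_quantale _ \<longleftrightarrow> (\<forall>p\<in>(Spec :: 'a set). \<exists>!q. q \<in> Min_Spec \<and> q \<le> p)"

text \<open>The reticulation is determined up to isomorphism, so it is given by its defining property:
  the type \<open>'b\<close> plays the role of $L(A)$ and \<open>lam\<close> that of $\lambda_A$. The values of \<open>lam\<close> outside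
  the compact elements are irrelevant.\<close>

definition is_reticulation ::
    "('a::coherent_quantale \<Rightarrow> 'b::{distrib_lattice, bounded_lattice}) \<Rightarrow> bool" where
  "is_reticulation lam \<longleftrightarrow>
     lam ` compacts = UNIV \<and>
     (\<forall>a\<in>compacts. \<forall>b\<in>compacts.
        lam (sup a b) \<le> sup (lam a) (lam b) \<and>
        lam (a * b) = inf (lam a) (lam b) \<and>
        (lam a \<le> lam b \<longleftrightarrow> (\<exists>n\<ge>1. a ^ n \<le> b)))"

definition conormal :: "'b::{distrib_lattice, bounded_lattice} itself \<Rightarrow> bool" where
  "conormal _ \<longleftrightarrow>
     (\<forall>x y :: 'b. inf x y = bot \<longrightarrow>
        (\<exists>u v. inf x u = bot \<and> inf y v = bot \<and> sup u v = top))"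

end

theory Submission
  imports Defs
begin

text \<open>Both directions rest on separating an element from a multiplicatively closed set of compact
  elements by an \<open>m\<close>-prime. Applied to the products \<open>c ^ n * s\<close>, with \<open>s\<close> compact and not
  below a given \<open>m\<close>-prime \<open>p\<close>, it shows: if no such product is \<open>0\<close>, then some \<open>m\<close>-prime below
  \<open>p\<close> is not above \<open>c\<close>.

  Let \<open>L(A)\<close> be conormal and \<open>q1 \<noteq> q2\<close> minimal \<open>m\<close>-primes below \<open>p\<close>. Pick a compact \<open>c \<le> q1\<close> with
  \<open>c\<close> not below \<open>q2\<close>; by minimality \<open>c ^ n * d = 0\<close> for some compact \<open>d\<close> not below \<open>q1\<close>, so
  conormality gives \<open>e \<squnion> f = 1\<close> with \<open>c * e\<close> and \<open>d * f\<close> nilpotent. Then \<open>e \<le> q2\<close> and \<open>f \<le> q1\<close>,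
  whence \<open>1 \<le> p\<close>.

  Conversely, if \<open>c * d\<close> is nilpotent and conormality fails at \<open>c, d\<close>, some \<open>m\<close>-prime \<open>p\<close> lies above
  every compact element whose product with \<open>c\<close> or with \<open>d\<close> is nilpotent. Hence there are minimal
  \<open>m\<close>-primes below \<open>p\<close> not above \<open>c\<close>, respectively \<open>d\<close>; they coincide in an \<open>mp\<close>-quantale, although
  every \<open>m\<close>-prime is above \<open>c\<close> or \<open>d\<close>.\<close>

section \<open>Arithmetic in quantales\<close>

lemma quantale_mult_sup: "(a::'a::quantale) * sup b c = sup (a * b) (a * c)"
  using mult_Sup[of a "{b, c}"] by simp

lemma quantale_mult_bot: "(a::'a::quantale) * bot = bot"
  using mult_Sup[of a "{}"] by simp

lemma quantale_mult_left_mono: "(b::'a::quantale) \<le> c \<Longrightarrow> a * b \<le> a * c"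
  by (metis le_iff_sup quantale_mult_sup)

lemma quantale_mult_mono: "(a::'a::quantale) \<le> b \<Longrightarrow> c \<le> d \<Longrightarrow> a * c \<le> b * d"
  by (metis quantale_mult_left_mono mult.commute order_trans)

lemma quantale_le_one: "(a::'a::quantale) \<le> 1"
  by (simp add: one_eq_top)

lemma quantale_mult_le_left: "(a::'a::quantale) * b \<le> a"
  using quantale_mult_left_mono[OF quantale_le_one, of a b] by simp

lemma quantale_mult_le_right: "(a::'a::quantale) * b \<le> b"
  using quantale_mult_le_left[of b a] by (simp add: mult.commute)

text \<open>On expanding the product, every term except \<open>x * y\<close> has a factor
  \<open>p\<close> and so lies below \<open>p\<close>. This makes maximal elements avoiding a
  multiplicative set \<open>m\<close>-prime.\<close>

lemma sup_mult_sup_le: "sup p x * sup p y \<le> sup p (x * (y::'a::quantale))"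
proof -
  have "sup p x * sup p y = sup (sup p x * p) (sup (y * p) (x * y))"
    by (simp add: quantale_mult_sup mult.commute[of _ y])
  also have "\<dots> \<le> sup p (x * y)"
    by (meson quantale_mult_le_right sup.boundedI sup.coboundedI1 sup_ge2)
  finally show ?thesis .
qed

section \<open>Compact elements and directed joins\<close>

lemma compacts_bot: "(bot::'a::complete_lattice) \<in> compacts"
  unfolding compacts_def compact_element_def by (auto intro: exI[of _ "{}"])

lemma compacts_finite_subcover:
  assumes "c \<in> compacts" "c \<le> Sup X"
  obtains F where "finite F" "F \<subseteq> X" "c \<le> Sup F"
  using assms unfolding compacts_def compact_element_def by blast

lemma compacts_sup:
  assumes "(a::'a::complete_lattice) \<in> compacts" "b \<in> compacts"
  shows "sup a b \<in> compacts"
  unfolding compacts_def compact_element_def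
proof (intro CollectI allI impI)
  fix X :: "'a set"
  assume "sup a b \<le> Sup X"
  then have "a \<le> Sup X" "b \<le> Sup X" by simp_all
  obtain F where F: "finite F" "F \<subseteq> X" "a \<le> Sup F"
    using compacts_finite_subcover[OF assms(1) \<open>a \<le> Sup X\<close>] .
  obtain G where G: "finite G" "G \<subseteq> X" "b \<le> Sup G"
    using compacts_finite_subcover[OF assms(2) \<open>b \<le> Sup X\<close>] .
  have "sup a b \<le> Sup (F \<union> G)"
    unfolding Sup_union_distrib using F(3) G(3) by (rule sup.mono)
  then show "\<exists>F. finite F \<and> F \<subseteq> X \<and> sup a b \<le> Sup F"
    using F(1,2) G(1,2) by (intro exI[of _ "F \<union> G"]) simp
qed

lemma finite_directed_bound:
  fixes X :: "'a::complete_lattice set"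
  assumes "finite F" "F \<subseteq> X" "X \<noteq> {}"
    and dir: "\<And>x y. x \<in> X \<Longrightarrow> y \<in> X \<Longrightarrow> \<exists>z\<in>X. x \<le> z \<and> y \<le> z"
  shows "\<exists>z\<in>X. Sup F \<le> z"
  using assms(1,2)
proof (induction F rule: finite_induct)
  case empty
  then show ?case using assms(3) by auto
next
  case (insert x F)
  then obtain z where "z \<in> X" "Sup F \<le> z" by auto
  then show ?case using dir[of x z] insert.prems by (auto intro: order_trans)
qed

lemma compacts_le_directed_Sup:
  fixes X :: "'a::complete_lattice set"
  assumes "c \<in> compacts" "c \<le> Sup X" "X \<noteq> {}"
    and "\<And>x y. x \<in> X \<Longrightarrow> y \<in> X \<Longrightarrow> \<exists>z\<in>X. x \<le> z \<and> y \<le> z"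
  shows "\<exists>z\<in>X. c \<le> z"
proof -
  obtain F where "finite F" "F \<subseteq> X" "c \<le> Sup F"
    using compacts_finite_subcover[OF assms(1,2)] .
  moreover obtain z where "z \<in> X" "Sup F \<le> z"
    using finite_directed_bound[OF \<open>finite F\<close> \<open>F \<subseteq> X\<close> assms(3,4)] by blast
  ultimately show ?thesis by (blast intro: order_trans)
qed

lemma coherent_le_iff_compacts:
  "(a::'a::coherent_quantale) \<le> b \<longleftrightarrow> (\<forall>c\<in>compacts. c \<le> a \<longrightarrow> c \<le> b)"
proof (intro iffI ballI impI)
  assume *: "\<forall>c\<in>compacts. c \<le> a \<longrightarrow> c \<le> b"
  obtain C where "C \<subseteq> compacts" "a = Sup C" using ex_compacts_Sup by blast
  then show "a \<le> b" using * by (metis Sup_least Sup_upper subsetD)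
qed auto

lemma compacts_power: "(a::'a::coherent_quantale) \<in> compacts \<Longrightarrow> a ^ n \<in> compacts"
  by (induction n) (auto simp: one_compact mult_compact)

section \<open>Existence of \<open>m\<close>-primes and of minimal \<open>m\<close>-primes\<close>

lemma Spec_mult_le: "p \<in> Spec \<Longrightarrow> a * b \<le> p \<Longrightarrow> a \<le> p \<or> b \<le> p"
  by (auto simp: Spec_def m_prime_def)

lemma Spec_not_one_le: "p \<in> Spec \<Longrightarrow> \<not> 1 \<le> p"
  by (auto simp: Spec_def m_prime_def)

lemma Spec_power_le: "p \<in> Spec \<Longrightarrow> a ^ n \<le> p \<Longrightarrow> a \<le> p"
  by (induction n) (auto dest: Spec_not_one_le Spec_mult_le)

text \<open>Zorn's lemma gives an element maximal among those above \<open>a\<close> with no member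
  of \<open>S\<close> below them. Compactness of the members of \<open>S\<close> keeps joins of
  chains in this set, and closure of \<open>S\<close> under products makes a maximal element
  \<open>m\<close>-prime.\<close>

lemma ex_Spec_avoiding:
  fixes S :: "'a::coherent_quantale set"
  assumes S: "S \<subseteq> compacts" "1 \<in> S" "\<And>s t. s \<in> S \<Longrightarrow> t \<in> S \<Longrightarrow> s * t \<in> S"
    and a: "\<And>s. s \<in> S \<Longrightarrow> \<not> s \<le> a"
  obtains p where "p \<in> Spec" "a \<le> p" "\<And>s. s \<in> S \<Longrightarrow> \<not> s \<le> p"
proof -
  define A where "A = {x. a \<le> x \<and> (\<forall>s\<in>S. \<not> s \<le> x)}"
  have "\<exists>m\<in>A. \<forall>x\<in>A. m \<le> x \<longrightarrow> x = m"
  proof (rule predicate_Zorn)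
    show "partial_order_on A (relation_of (\<le>) A)"
      by (rule partial_order_on_relation_ofI) auto
  next
    fix C assume "C \<in> Chains (relation_of (\<le>) A)"
    then have C: "C \<subseteq> A" "\<And>x y. x \<in> C \<Longrightarrow> y \<in> C \<Longrightarrow> x \<le> y \<or> y \<le> x"
      unfolding Chains_def relation_of_def by auto
    show "\<exists>u\<in>A. \<forall>x\<in>C. x \<le> u"
    proof (cases "C = {}")
      case True
      then show ?thesis using a unfolding A_def by auto
    next
      case False
      have "\<not> s \<le> Sup C" if "s \<in> S" for s
      proof
        assume "s \<le> Sup C"
        then have "\<exists>z\<in>C. s \<le> z"
          using that S(1) False C(2) by (intro compacts_le_directed_Sup) auto
        then show False using C(1) that unfolding A_def by auto
      qed
      moreover have "a \<le> Sup C"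
        using False C(1) unfolding A_def by (auto intro: Sup_upper2)
      ultimately have "Sup C \<in> A" unfolding A_def by auto
      then show ?thesis by (auto intro: Sup_upper)
    qed
  qed
  then obtain p where p: "p \<in> A" and max: "\<And>x. x \<in> A \<Longrightarrow> p \<le> x \<Longrightarrow> x = p" by auto
  \<comment> \<open>By maximality \<open>sup p x\<close> has left \<open>A\<close>; as it is still
    above \<open>a\<close>, some member of \<open>S\<close> must lie below it.\<close>
  have above: "\<exists>s\<in>S. s \<le> sup p x" if "\<not> x \<le> p" for x
  proof (rule ccontr)
    assume "\<not> ?thesis"
    with p have "sup p x \<in> A" unfolding A_def by (auto intro: le_supI1)
    then show False using max[of "sup p x"] that by (metis sup_ge1 sup_ge2)
  qed
  have "x \<le> p \<or> y \<le> p" if xy: "x * y \<le> p" for x y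
  proof (rule ccontr)
    assume "\<not> ?thesis"
    then obtain s t where st: "s \<in> S" "t \<in> S" "s \<le> sup p x" "t \<le> sup p y"
      using above by blast
    have "s * t \<le> sup p (x * y)"
      using quantale_mult_mono[OF st(3,4)] sup_mult_sup_le by (rule order_trans)
    also have "\<dots> = p" using xy by (simp add: sup_absorb1)
    finally show False using S(3)[OF st(1,2)] p unfolding A_def by auto
  qed
  moreover have "p < 1" using p S(2) quantale_le_one[of p] unfolding A_def by (auto simp: less_le_not_le)
  ultimately have "p \<in> Spec" by (auto simp: Spec_def m_prime_def)
  with p show ?thesis using that unfolding A_def by auto
qed

text \<open>Zorn's lemma for the reversed order: the meet of a nonempty chain of
  \<open>m\<close>-primes is again \<open>m\<close>-prime.\<close>

lemma ex_Min_Spec_le: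
  fixes p :: "'a::quantale"
  assumes "p \<in> Spec"
  obtains q where "q \<in> Min_Spec" "q \<le> p"
proof -
  define A where "A = {x \<in> Spec. x \<le> p}"
  have "\<exists>m\<in>A. \<forall>x\<in>A. m \<ge> x \<longrightarrow> x = m"
  proof (rule predicate_Zorn)
    show "partial_order_on A (relation_of (\<ge>) A)"
      by (rule partial_order_on_relation_ofI) auto
  next
    fix C assume "C \<in> Chains (relation_of (\<ge>) A)"
    then have C: "C \<subseteq> A" "\<And>x y. x \<in> C \<Longrightarrow> y \<in> C \<Longrightarrow> x \<le> y \<or> y \<le> x"
      unfolding Chains_def relation_of_def by auto
    show "\<exists>u\<in>A. \<forall>x\<in>C. x \<ge> u"
    proof (cases "C = {}")
      case True
      then show ?thesis using assms unfolding A_def by auto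
    next
      case False
      then obtain r where r: "r \<in> C" by auto
      then have rA: "r \<in> Spec" "r \<le> p" using C(1) unfolding A_def by auto
      have "Inf C \<le> r" using r by (rule Inf_lower)
      have "x \<le> Inf C \<or> y \<le> Inf C" if xy: "x * y \<le> Inf C" for x y
      proof (rule ccontr)
        assume "\<not> ?thesis"
        then obtain s t where st: "s \<in> C" "t \<in> C" "\<not> x \<le> s" "\<not> y \<le> t"
          by (auto simp: le_Inf_iff)
        \<comment> \<open>The smaller of \<open>s\<close> and \<open>t\<close> is above neither
          \<open>x\<close> nor \<open>y\<close>.\<close>
        then obtain z where "z \<in> C" "\<not> x \<le> z" "\<not> y \<le> z"
          using C(2)[OF st(1,2)] by (meson order_trans)
        moreover have "x * y \<le> z" using xy \<open>z \<in> C\<close> by (meson Inf_lower order_trans)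
        ultimately show False using C(1) Spec_mult_le unfolding A_def by blast
      qed
      moreover have "Inf C < 1"
        using \<open>Inf C \<le> r\<close> rA(1) by (auto simp: Spec_def m_prime_def)
      ultimately have "Inf C \<in> A"
        using \<open>Inf C \<le> r\<close> rA(2) by (auto simp: A_def Spec_def m_prime_def)
      then show ?thesis by (auto intro: Inf_lower)
    qed
  qed
  then obtain q where "q \<in> A" "\<And>x. x \<in> A \<Longrightarrow> x \<le> q \<Longrightarrow> x = q" by auto
  then have "q \<in> Min_Spec" "q \<le> p"
    unfolding A_def Min_Spec_def by (auto intro: order_trans)
  then show ?thesis using that by blast
qed

lemma ex_Spec_le_not_above:
  fixes p c :: "'a::coherent_quantale"
  assumes p: "p \<in> Spec" and c: "c \<in> compacts"
    and nz: "\<And>n s. s \<in> compacts \<Longrightarrow> \<not> s \<le> p \<Longrightarrow> c ^ n * s \<noteq> bot"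
  obtains q where "q \<in> Spec" "q \<le> p" "\<not> c \<le> q"
proof -
  define S where "S = {c ^ n * s |n s. s \<in> compacts \<and> \<not> s \<le> p}"
  have SI: "c ^ n * s \<in> S" if "s \<in> compacts" "\<not> s \<le> p" for n s
    using that unfolding S_def by auto
  have one: "1 \<in> S"
    using SI[of 1 0] Spec_not_one_le[OF p] one_compact by simp
  have "s * t \<in> S" if st: "s \<in> S" "t \<in> S" for s t
  proof -
    obtain m u n v where uv: "s = c ^ m * u" "t = c ^ n * v" "u \<in> compacts" "v \<in> compacts"
      "\<not> u \<le> p" "\<not> v \<le> p"
      using st unfolding S_def by auto
    have "s * t = c ^ (m + n) * (u * v)" by (simp add: uv power_add ac_simps)
    moreover have "\<not> u * v \<le> p" using Spec_mult_le[OF p] uv by blast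
    ultimately show ?thesis using SI[of "u * v" "m + n"] uv(3,4) by (simp add: mult_compact)
  qed
  moreover have "S \<subseteq> compacts" using c by (auto simp: S_def intro: mult_compact compacts_power)
  moreover have "\<not> s \<le> bot" if "s \<in> S" for s
    using that nz unfolding S_def by (auto simp: bot_unique)
  ultimately obtain q where q: "q \<in> Spec" "\<And>s. s \<in> S \<Longrightarrow> \<not> s \<le> q"
    using one by (rule_tac ex_Spec_avoiding[of S bot]) auto
  \<comment> \<open>The choice \<open>n = 1\<close>, \<open>s = 1\<close> puts \<open>c\<close>
    itself into \<open>S\<close>.\<close>
  have "\<not> c \<le> q"
    using q(2)[OF SI[of 1 1]] Spec_not_one_le[OF p] one_compact by simp
  \<comment> \<open>The choice \<open>n = 0\<close> puts into \<open>S\<close> every compact element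
    not below \<open>p\<close>, so each compact element below \<open>q\<close> is below
    \<open>p\<close>.\<close>
  moreover have "q \<le> p"
    using q(2) SI[of _ 0] by (subst coherent_le_iff_compacts) auto
  ultimately show ?thesis using that q(1) by blast
qed

lemma Min_Spec_annihilator:
  fixes q c :: "'a::coherent_quantale"
  assumes "q \<in> Min_Spec" "c \<in> compacts" "c \<le> q"
  obtains n d where "d \<in> compacts" "\<not> d \<le> q" "c ^ n * d = bot"
proof (rule ccontr)
  assume "\<not> thesis"
  with that have "\<And>n s. s \<in> compacts \<Longrightarrow> \<not> s \<le> q \<Longrightarrow> c ^ n * s \<noteq> bot" by blast
  \<comment> \<open>Minimality forces \<open>r = q\<close>, which is above \<open>c\<close>.\<close>
  then obtain r where "r \<in> Spec" "r \<le> q" "\<not> c \<le> r"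
    using ex_Spec_le_not_above[of q c] assms unfolding Min_Spec_def by blast
  then show False using assms unfolding Min_Spec_def by auto
qed

section \<open>Transfer between nilpotent products and disjointness in the reticulation\<close>

context
  fixes lam :: "'a::coherent_quantale \<Rightarrow> 'b::{distrib_lattice, bounded_lattice}"
  assumes ret: "is_reticulation lam"
begin

lemma reticulation_surj: "\<exists>c\<in>compacts. lam c = x"
  using ret unfolding is_reticulation_def by (metis imageE UNIV_I)

lemma reticulation_le_iff:
  "a \<in> compacts \<Longrightarrow> b \<in> compacts \<Longrightarrow> lam a \<le> lam b \<longleftrightarrow> (\<exists>n\<ge>1. a ^ n \<le> b)"
  using ret unfolding is_reticulation_def by blast

lemma reticulation_mult:
  "a \<in> compacts \<Longrightarrow> b \<in> compacts \<Longrightarrow> lam (a * b) = inf (lam a) (lam b)"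
  using ret unfolding is_reticulation_def by blast

lemma reticulation_mono:
  "a \<in> compacts \<Longrightarrow> b \<in> compacts \<Longrightarrow> a \<le> b \<Longrightarrow> lam a \<le> lam b"
  by (subst reticulation_le_iff) (auto intro: exI[of _ 1])

lemma reticulation_sup:
  assumes "a \<in> compacts" "b \<in> compacts"
  shows "lam (sup a b) = sup (lam a) (lam b)"
proof (rule antisym)
  show "lam (sup a b) \<le> sup (lam a) (lam b)"
    using ret assms unfolding is_reticulation_def by blast
  show "sup (lam a) (lam b) \<le> lam (sup a b)"
    using assms by (auto intro: reticulation_mono compacts_sup)
qed

lemma reticulation_bot: "lam bot = bot"
proof -
  obtain c where "c \<in> compacts" "lam c = bot" using reticulation_surj by blast
  then have "lam bot \<le> bot"
    using reticulation_mono[OF compacts_bot _ bot_least] by metis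
  then show ?thesis by (rule bot.extremum_uniqueI)
qed

lemma reticulation_one: "lam 1 = top"
proof -
  obtain c where "c \<in> compacts" "lam c = top" using reticulation_surj by blast
  then have "top \<le> lam 1"
    using reticulation_mono[OF _ one_compact quantale_le_one] by metis
  then show ?thesis by (rule top_le)
qed

lemma reticulation_eq_bot_iff: "a \<in> compacts \<Longrightarrow> lam a = bot \<longleftrightarrow> (\<exists>n\<ge>1. a ^ n = bot)"
  using reticulation_le_iff[OF _ compacts_bot, of a] by (simp add: reticulation_bot bot_unique)

lemma reticulation_eq_top_iff: "a \<in> compacts \<Longrightarrow> lam a = top \<longleftrightarrow> a = 1"
  using reticulation_le_iff[OF one_compact, of a] quantale_le_one[of a]
  by (auto simp: reticulation_one top_unique intro: antisym)

lemma Spec_ge_of_inf_eq_bot: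
  assumes "a \<in> compacts" "b \<in> compacts" "inf (lam a) (lam b) = bot" "p \<in> Spec"
  shows "a \<le> p \<or> b \<le> p"
proof -
  obtain n where "(a * b) ^ n = bot"
    using assms(1-3) reticulation_eq_bot_iff[OF mult_compact] reticulation_mult by metis
  then show ?thesis
    using Spec_power_le[OF assms(4), of "a * b" n] Spec_mult_le[OF assms(4)] by simp
qed

lemma inf_reticulation_eq_bot:
  assumes "a \<in> compacts" "b \<in> compacts" "a ^ n * b = bot"
  shows "inf (lam a) (lam b) = bot"
proof -
  \<comment> \<open>The reticulation asks for an exponent of at least 1; \<open>Suc n\<close>
    ensures this even when \<open>n = 0\<close>.\<close>
  have "(a * b) ^ Suc n = (a ^ n * b) * (a * b ^ n)"
    by (simp add: power_mult_distrib ac_simps)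
  also have "\<dots> = bot" unfolding assms(3) by (metis quantale_mult_bot mult.commute)
  finally have "lam (a * b) = bot"
    using assms reticulation_eq_bot_iff[OF mult_compact] by (metis le_add1 plus_1_eq_Suc)
  then show ?thesis using assms reticulation_mult by simp
qed

section \<open>The two implications\<close>

lemma conormal_imp_mp_quantale:
  assumes con: "conormal TYPE('b)"
  shows "mp_quantale TYPE('a)"
  unfolding mp_quantale_def
proof
  fix p :: 'a assume p: "p \<in> Spec"
  \<comment> \<open>One inequality suffices: exchanging \<open>q1\<close> and \<open>q2\<close>
    gives the other.\<close>
  have le: "q1 \<le> q2"
    if q: "q1 \<in> Min_Spec" "q1 \<le> p" "q2 \<in> Min_Spec" "q2 \<le> p" for q1 q2
  proof (rule ccontr)
    assume "\<not> q1 \<le> q2"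
    then obtain c where c: "c \<in> compacts" "c \<le> q1" "\<not> c \<le> q2"
      using coherent_le_iff_compacts by blast
    obtain n d where d: "d \<in> compacts" "\<not> d \<le> q1" "c ^ n * d = bot"
      using Min_Spec_annihilator[OF q(1) c(1,2)] by blast
    obtain u v where uv: "inf (lam c) u = bot" "inf (lam d) v = bot" "sup u v = top"
      using con inf_reticulation_eq_bot[OF c(1) d(1,3)] unfolding conormal_def by blast
    obtain e where e: "e \<in> compacts" "lam e = u" using reticulation_surj by blast
    obtain f where f: "f \<in> compacts" "lam f = v" using reticulation_surj by blast
    \<comment> \<open>An \<open>m\<close>-prime is above one of two compact elements with disjoint
      images; \<open>q2\<close> is not above \<open>c\<close>, and \<open>q1\<close> is not above
      \<open>d\<close>.\<close>
    have "e \<le> q2" "f \<le> q1"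
      using Spec_ge_of_inf_eq_bot[OF c(1) e(1), of q2] Spec_ge_of_inf_eq_bot[OF d(1) f(1), of q1]
        uv e f c d q unfolding Min_Spec_def by auto
    moreover have "sup e f = 1"
      using uv e f reticulation_eq_top_iff[OF compacts_sup] reticulation_sup by metis
    ultimately have "1 \<le> p" using q by (metis le_supI order_trans)
    then show False using Spec_not_one_le[OF p] by simp
  qed
  obtain q where q: "q \<in> Min_Spec" "q \<le> p" using ex_Min_Spec_le[OF p] .
  then show "\<exists>!q. q \<in> Min_Spec \<and> q \<le> p"
    using le by (blast intro: antisym)
qed

text \<open>If \<open>c ^ n * s\<close> vanished, \<open>lam c\<close> and \<open>lam s\<close>
  would be disjoint and \<open>ann\<close> would put \<open>s\<close> below \<open>p\<close>. So
  some \<open>m\<close>-prime below \<open>p\<close> is not above \<open>c\<close>, and neither is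
  any minimal one below it.\<close>

lemma ex_Min_Spec_not_above:
  assumes p: "p \<in> Spec" and c: "c \<in> compacts"
    and ann: "\<And>s. s \<in> compacts \<Longrightarrow> inf (lam c) (lam s) = bot \<Longrightarrow> s \<le> p"
  obtains q where "q \<in> Min_Spec" "q \<le> p" "\<not> c \<le> q"
proof -
  obtain r where r: "r \<in> Spec" "r \<le> p" "\<not> c \<le> r"
  proof (rule ex_Spec_le_not_above[OF p c])
    show "c ^ n * s \<noteq> bot" if "s \<in> compacts" "\<not> s \<le> p" for n s
      using that ann inf_reticulation_eq_bot[OF c that(1)] by blast
  qed
  obtain q where "q \<in> Min_Spec" "q \<le> r" using ex_Min_Spec_le[OF r(1)] .
  then show ?thesis using that r by (meson order_trans)
qed

lemma mp_quantale_imp_conormal: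
  assumes mp: "mp_quantale TYPE('a)"
  shows "conormal TYPE('b)"
  unfolding conormal_def
proof (intro allI impI)
  fix x y :: 'b assume xy: "inf x y = bot"
  obtain c where c: "c \<in> compacts" "lam c = x" using reticulation_surj by blast
  obtain d where d: "d \<in> compacts" "lam d = y" using reticulation_surj by blast
  \<comment> \<open>Candidates for a conormality witness, which succeeds when \<open>sup e f\<close>
    is 1. The set is directed, so by compactness of 1 failure means that \<open>Sup X\<close> is
    proper.\<close>
  define X where "X = {sup e f |e f. e \<in> compacts \<and> f \<in> compacts \<and>
    inf x (lam e) = bot \<and> inf y (lam f) = bot}"
  have XI: "sup e f \<in> X"
    if "e \<in> compacts" "f \<in> compacts" "inf x (lam e) = bot" "inf y (lam f) = bot" for e f
    using that unfolding X_def by auto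
  have X_ge: "\<exists>z\<in>X. a \<le> z \<and> b \<le> z" if ab: "a \<in> X" "b \<in> X" for a b
  proof -
    obtain e f e' f' where *: "a = sup e f" "b = sup e' f'" "e \<in> compacts" "f \<in> compacts"
      "e' \<in> compacts" "f' \<in> compacts" "inf x (lam e) = bot" "inf y (lam f) = bot"
      "inf x (lam e') = bot" "inf y (lam f') = bot"
      using ab unfolding X_def by auto
    then have "sup (sup e e') (sup f f') \<in> X"
      by (intro XI) (auto simp: compacts_sup reticulation_sup inf_sup_distrib1)
    then show ?thesis unfolding *(1,2) by (rule bexI[rotated]) (simp add: le_supI1 le_supI2)
  qed
  show "\<exists>u v. inf x u = bot \<and> inf y v = bot \<and> sup u v = top"
  proof (cases "1 \<le> Sup X")
    case True
    have "X \<noteq> {}" using XI[OF compacts_bot compacts_bot] by (auto simp: reticulation_bot)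
    then obtain z where "z \<in> X" "1 \<le> z"
      using compacts_le_directed_Sup[OF one_compact True] X_ge by blast
    then obtain e f where "e \<in> compacts" "f \<in> compacts" "inf x (lam e) = bot"
      "inf y (lam f) = bot" "sup e f = 1"
      unfolding X_def using quantale_le_one by (auto intro: antisym)
    then show ?thesis by (metis reticulation_sup reticulation_one)
  next
    case False
    \<comment> \<open>Avoiding \<open>{1}\<close> just means being proper.\<close>
    then obtain p where p: "p \<in> Spec" "Sup X \<le> p"
      using one_compact by (rule_tac ex_Spec_avoiding[of "{1}" "Sup X"]) auto
    have ann: "s \<le> p" if "s \<in> compacts" "inf x (lam s) = bot \<or> inf y (lam s) = bot" for s
    proof -
      \<comment> \<open>Write \<open>s\<close> as a join with \<open>bot\<close>, on whichever side
        its disjointness requires.\<close>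
      have "s \<in> X"
        using that XI[OF _ compacts_bot, of s] XI[OF compacts_bot, of s]
        by (auto simp: reticulation_bot)
      then show ?thesis using p(2) by (meson Sup_upper order_trans)
    qed
    obtain q1 where q1: "q1 \<in> Min_Spec" "q1 \<le> p" "\<not> c \<le> q1"
      using ex_Min_Spec_not_above[OF p(1) c(1)] ann c(2) by blast
    obtain q2 where q2: "q2 \<in> Min_Spec" "q2 \<le> p" "\<not> d \<le> q2"
      using ex_Min_Spec_not_above[OF p(1) d(1)] ann d(2) by blast
    have "q1 = q2" using mp p(1) q1 q2 unfolding mp_quantale_def by blast
    moreover have "c \<le> q1 \<or> d \<le> q1"
      using Spec_ge_of_inf_eq_bot[OF c(1) d(1)] c d xy q1(1) unfolding Min_Spec_def by auto
    ultimately show ?thesis using q1 q2 by auto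
  qed
qed

end

theorem corollary8p10:
  fixes lam :: "'a::coherent_quantale \<Rightarrow> 'b::{distrib_lattice, bounded_lattice}"
  assumes "is_reticulation lam"
  shows "mp_quantale TYPE('a) \<longleftrightarrow> conormal TYPE('b)"
  using conormal_imp_mp_quantale[OF assms] mp_quantale_imp_conormal[OF assms] by blast

end
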